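(* Under the model described in the context, for every $h\in\mathbb{T}$ the filtered process $\hat I^h_n=\mathbb{E}[\mathbf 1_{[\Theta_n=h]}\mid\mathcal{F}^N_n]$ satisfies, almost surely, for every $n=1,\dots,\Gamma$, $$\hat I_n^h=\sum_{\delta\in\mathbb{J}_n^{\otimes}}\frac{\sum_{s=1}^m K^{sh}\prod_{i,r=1}^p (L^{s,ir})^{\delta_{ir}}\,\hat I^s_{n-1}}{\sum_{s=1}^m \prod_{i,r=1}^p (L^{s,ir})^{\delta_{ir}}\,\hat I^s_{n-1}}\;\mathbf 1_{[\Delta N_n=\delta]}.$$
   Context: Let $\Gamma\in\mathbb{N}$ and let $(\Omega,\mathbf{A},\mathbf F=(\mathcal{F}_n)_{n\in\{0,\dots,\Gamma\}},\mathbb{P})$ be a filtered probability space; all processes are $\mathbf F$-adapted. Hidden factor: $\Theta=(\Theta_n)_{0\le n\le\Gamma}$ is a Markov chain with values in $\mathbb{T}=\{1,\dots,m\}$ and constant transition probabilities $K^{sh}=\mathbb{P}(\Theta_n=h\mid\Theta_{n-1}=s)$. It is Markov relative to $\mathbf F$: $\mathbb{P}(\Theta_n=h\mid\mathcal{F}_{n-1})=K^{\Theta_{n-1}h}$. Ratings: the rating categories are $\bar\Upsilon=\{1,\dots,p\}$, completed with a censoring category $0$ to $\Upsilon=\{0,\dots,p\}$. There are $Q$ entities, and $Z^q_n\in\Upsilon$ is the rating of entity $q\in\{1,\dots,Q\}$ at time $n$. For $(i,r)\in\Upsilon^2$, $N^{ir}$ counts the transitions from $i$ to $r$ (including $i=r$):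 $N^{ir}_0=0$ and $\Delta N^{ir}_n=N^{ir}_n-N^{ir}_{n-1}=\sum_{q\le Q}\mathbf 1_{[Z^q_{n-1}=i,\;Z^q_n=r]}$ for $n\ge 1$. Write $N=(N^{ir})_{i,r\in\Upsilon}$ and $\Delta N_n=(\Delta N_n^{ir})_{i,r\in\Upsilon}$; $\mathbf F^N=(\mathcal{F}^N_n)_n$ is the natural filtration of $N$ augmented with the $\mathbb{P}$-null sets. For $i\in\Upsilon$, $Y^i_n$ is the number of entities with rating $i$ at time $n-1$ (those that may jump from $i$ at time $n$); the processes $Y^i$ are assumed $\mathbf F^N$-predictable ($Y_n^i$ is $\mathcal{F}_{n-1}^N$-measurable). Let $\mathbb{J}^i_n=\{0,\dots,Y^i_n\}$ and let $\mathbb{J}^\otimes_n$ be the set of arrays $\delta=(\delta_{ir})_{i,r\in\Upsilon}$ with $\delta_{ir}\in\mathbb{J}_n^i$. Conditional transition probabilities: $L^{s,ir}=\mathbb{P}(Z^q_n=r\mid Z^q_{n-1}=i,\Theta_{n-1}=s)$ for $(i,r)\in\Upsilon^2$, $s\in\mathbb{T}$ (not depending on $q$ or $n$). If $i=0$ or $r=0$, $L^{s,ir}$ does not depend on $s$ (censoring is non-informative). Conditionally on $\mathcal{F}_{n-1}$, the variables $Z^1_n,\dots,Z^Q_n,\Theta_n$ are independent, with $\mathbb{P}(Z^q_n=r\mid\mathcal{F}_{n-1})=L^{\Theta_{n-1},\,Z^q_{n-1}r}$; in particular, given $\{\Theta_{n-1}=s,\,Y^i_n=y^i\}$, the vector $(\Delta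 N^{ir}_n)_{r\in\Upsilon}$ is multinomial with parameters $(y^i,(L^{s,ir})_{r\in\Upsilon})$. Conventions: $\hat I_0^h=\mathbb{E}[\mathbf 1_{[\Theta_0=h]}\mid\mathcal{F}^N_0]$; $0^0=1$; a quotient with zero denominator is taken to be $0$ (almost surely this never occurs on the corresponding event $\{\Delta N_n=\delta\}$). *)

theory Defs
  imports "HOL-Probability.Probability"
begin

abbreviation cond_prob_given :: "'a measure \<Rightarrow> 'a measure \<Rightarrow> 'a set \<Rightarrow> 'a \<Rightarrow> real" where
  "cond_prob_given M G A \<equiv> real_cond_exp M G (indicator A)"

definition cond_indep_vars ::
    "'a measure \<Rightarrow> 'a measure \<Rightarrow> ('i \<Rightarrow> 'b measure) \<Rightarrow> ('i \<Rightarrow> 'a \<Rightarrow> 'b) \<Rightarrow> 'i set \<Rightarrow> bool" where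
  "cond_indep_vars M G M' X I \<longleftrightarrow>
     (\<forall>i\<in>I. X i \<in> measurable M (M' i)) \<and>
     (\<forall>J\<subseteq>I. finite J \<longrightarrow> J \<noteq> {} \<longrightarrow> (\<forall>A\<in>(\<Pi> j\<in>J. sets (M' j)).
        AE \<omega> in M. cond_prob_given M G (\<Inter>j\<in>J. X j -` A j \<inter> space M) \<omega>
                 = (\<Prod>j\<in>J. cond_prob_given M G (X j -` A j \<inter> space M) \<omega>)))"

text \<open>
  Throughout, \<open>Z q n \<omega>\<close> is the rating of entity \<open>q \<in> {1..Q}\<close> at time \<open>n\<close>, with values in
  \<open>{0..p}\<close>; the category \<open>0\<close> is censoring.
\<close>

primrec transition_count ::
    "nat \<Rightarrow> (nat \<Rightarrow> nat \<Rightarrow> 'a \<Rightarrow> nat) \<Rightarrow> nat \<Rightarrow> nat \<Rightarrow> nat \<Rightarrow> 'a \<Rightarrow> nat" where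
  "transition_count Q Z i r 0 \<omega> = 0"
| "transition_count Q Z i r (Suc n) \<omega> = transition_count Q Z i r n \<omega>
     + (\<Sum>q=1..Q. of_bool (Z q n \<omega> = i \<and> Z q (Suc n) \<omega> = r))"

text \<open>The count is nondecreasing in time, so the subtraction below does not truncate.\<close>

definition transition_incr ::
    "nat \<Rightarrow> (nat \<Rightarrow> nat \<Rightarrow> 'a \<Rightarrow> nat) \<Rightarrow> nat \<Rightarrow> nat \<Rightarrow> nat \<Rightarrow> 'a \<Rightarrow> nat" where
  "transition_incr Q Z i r n \<omega>
     = transition_count Q Z i r n \<omega> - transition_count Q Z i r (n - 1) \<omega>"

definition at_risk :: "nat \<Rightarrow> (nat \<Rightarrow> nat \<Rightarrow> 'a \<Rightarrow> nat) \<Rightarrow> nat \<Rightarrow> nat \<Rightarrow> 'a \<Rightarrow> nat" where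
  "at_risk Q Z i n \<omega> = card {q \<in> {1..Q}. Z q (n - 1) \<omega> = i}"

text \<open>
  The natural filtration of the transition counts, augmented with the null sets of \<open>M\<close>
  (\<open>M\<close> itself need not be complete).
\<close>

definition count_filtration ::
    "'a measure \<Rightarrow> nat \<Rightarrow> nat \<Rightarrow> (nat \<Rightarrow> nat \<Rightarrow> 'a \<Rightarrow> nat) \<Rightarrow> nat \<Rightarrow> 'a measure" where
  "count_filtration M p Q Z n = sigma (space M)
     ({transition_count Q Z i r k -` A \<inter> space M | i r k A. i \<le> p \<and> r \<le> p \<and> k \<le> n}
      \<union> null_sets M)"

definition hidden_filter ::
    "'a measure \<Rightarrow> nat \<Rightarrow> nat \<Rightarrow> (nat \<Rightarrow> nat \<Rightarrow> 'a \<Rightarrow> nat) \<Rightarrow> (nat \<Rightarrow> 'a \<Rightarrow> nat)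
     \<Rightarrow> nat \<Rightarrow> nat \<Rightarrow> 'a \<Rightarrow> real" where
  "hidden_filter M p Q Z \<Theta> h n
     = cond_prob_given M (count_filtration M p Q Z n) {\<omega> \<in> space M. \<Theta> n \<omega> = h}"

text \<open>Arrays \<open>(\<delta>\<^sub>i\<^sub>r)\<close> are extensional functions on pairs, which makes this set finite.\<close>

definition jump_arrays ::
    "nat \<Rightarrow> nat \<Rightarrow> (nat \<Rightarrow> nat \<Rightarrow> 'a \<Rightarrow> nat) \<Rightarrow> nat \<Rightarrow> 'a \<Rightarrow> (nat \<times> nat \<Rightarrow> nat) set" where
  "jump_arrays p Q Z n \<omega> = (\<Pi>\<^sub>E (i, r) \<in> {0..p} \<times> {0..p}. {0..at_risk Q Z i n \<omega>})"

text \<open>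
  \<open>K\<close> and \<open>L\<close> are tied to elementary conditional probabilities only where the conditioning
  event has positive probability.  In \<open>cond_indep\<close>, the index \<open>None\<close> stands for the hidden
  factor and \<open>Some q\<close> for entity \<open>q\<close>.
\<close>

locale rating_model = prob_space M
  for M :: "'a measure" +
  fixes \<Gamma> :: nat
    and F :: "nat \<Rightarrow> 'a measure"
    and m :: nat
    and \<Theta> :: "nat \<Rightarrow> 'a \<Rightarrow> nat"
    and K :: "nat \<Rightarrow> nat \<Rightarrow> real"
    and p Q :: nat
    and Z :: "nat \<Rightarrow> nat \<Rightarrow> 'a \<Rightarrow> nat"
    and L :: "nat \<Rightarrow> nat \<Rightarrow> nat \<Rightarrow> real"
  assumes subalg: "n \<le> \<Gamma> \<Longrightarrow> subalgebra M (F n)"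
    and mono: "k \<le> n \<Longrightarrow> n \<le> \<Gamma> \<Longrightarrow> sets (F k) \<subseteq> sets (F n)"
    and Theta_adapted: "n \<le> \<Gamma> \<Longrightarrow> \<Theta> n \<in> measurable (F n) (count_space UNIV)"
    and Theta_range: "n \<le> \<Gamma> \<Longrightarrow> \<omega> \<in> space M \<Longrightarrow> \<Theta> n \<omega> \<in> {1..m}"
    and Theta_transition:
      "n \<in> {1..\<Gamma>} \<Longrightarrow> s \<in> {1..m} \<Longrightarrow> h \<in> {1..m} \<Longrightarrow>
       \<P>(\<omega> in M. \<Theta> (n - 1) \<omega> = s) > 0 \<Longrightarrow>
       K s h = \<P>(\<omega> in M. \<Theta> n \<omega> = h \<bar> \<Theta> (n - 1) \<omega> = s)"
    and Theta_Markov: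
      "n \<in> {1..\<Gamma>} \<Longrightarrow> h \<in> {1..m} \<Longrightarrow>
       AE \<omega> in M. cond_prob_given M (F (n - 1)) {\<omega> \<in> space M. \<Theta> n \<omega> = h} \<omega>
                = K (\<Theta> (n - 1) \<omega>) h"
    and Z_adapted: "q \<in> {1..Q} \<Longrightarrow> n \<le> \<Gamma> \<Longrightarrow> Z q n \<in> measurable (F n) (count_space UNIV)"
    and Z_range: "q \<in> {1..Q} \<Longrightarrow> n \<le> \<Gamma> \<Longrightarrow> \<omega> \<in> space M \<Longrightarrow> Z q n \<omega> \<in> {0..p}"
    and at_risk_predictable:
      "i \<in> {0..p} \<Longrightarrow> n \<in> {1..\<Gamma>} \<Longrightarrow>
       at_risk Q Z i n \<in> measurable (count_filtration M p Q Z (n - 1)) (count_space UNIV)"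
    and Z_transition:
      "q \<in> {1..Q} \<Longrightarrow> n \<in> {1..\<Gamma>} \<Longrightarrow> s \<in> {1..m} \<Longrightarrow> i \<in> {0..p} \<Longrightarrow> r \<in> {0..p} \<Longrightarrow>
       \<P>(\<omega> in M. Z q (n - 1) \<omega> = i \<and> \<Theta> (n - 1) \<omega> = s) > 0 \<Longrightarrow>
       L s i r = \<P>(\<omega> in M. Z q n \<omega> = r \<bar> Z q (n - 1) \<omega> = i \<and> \<Theta> (n - 1) \<omega> = s)"
    and censoring_noninformative:
      "s \<in> {1..m} \<Longrightarrow> s' \<in> {1..m} \<Longrightarrow> i \<in> {0..p} \<Longrightarrow> r \<in> {0..p} \<Longrightarrow> i = 0 \<or> r = 0 \<Longrightarrow>
       L s i r = L s' i r"
    and cond_indep: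
      "n \<in> {1..\<Gamma>} \<Longrightarrow>
       cond_indep_vars M (F (n - 1)) (\<lambda>_. count_space UNIV)
         (case_option (\<Theta> n) (\<lambda>q. Z q n)) (insert None (Some ` {1..Q}))"
    and Z_cond_transition:
      "q \<in> {1..Q} \<Longrightarrow> n \<in> {1..\<Gamma>} \<Longrightarrow> r \<in> {0..p} \<Longrightarrow>
       AE \<omega> in M. cond_prob_given M (F (n - 1)) {\<omega> \<in> space M. Z q n \<omega> = r} \<omega>
                = L (\<Theta> (n - 1) \<omega>) (Z q (n - 1) \<omega>) r"

end

theory Submission
  imports Defs "HOL-Combinatorics.Permutations"
begin

text \<open>
  The counts take countably many values, so up to null sets \<open>\<F>\<^sup>N\<^sub>n\<close> is generated by atoms, and the
  filter is the elementary conditional probability given the atom containing \<open>\<omega>\<close>.  On an atom of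
  \<open>\<F>\<^sup>N\<^sub>n\<^sub>-\<^sub>1\<close>, conditioning on \<open>\<F>\<^sub>n\<^sub>-\<^sub>1\<close> and summing over all rating profiles with transition array \<open>\<delta>\<close>
  gives the joint law of \<open>\<Theta>\<^sub>n\<close> and \<open>\<Delta>N\<^sub>n\<close>: each such profile contributes the same product of the
  \<open>L\<^sup>s\<^sup>,\<^sup>i\<^sup>r\<close>, and their number depends only on the occupation numbers of the previous profile, which are
  constant on the atom by predictability.  Both this number and the censoring factors are independent
  of the hidden state and cancel in Bayes' formula.
\<close>

section \<open>Combinatorics of rating profiles with a prescribed transition array\<close>

text \<open>Extensional functions keep the set finite, so that its cardinality counts rating
  assignments. If \<open>z\<close> has values in \<open>{0..p}\<close> and its occupation numbers
  are the row sums of \<open>\<delta>\<close>, the cardinality is a product of multinomial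
  coefficients.\<close>

definition successors ::
    "nat \<Rightarrow> nat \<Rightarrow> (nat \<times> nat \<Rightarrow> nat) \<Rightarrow> (nat \<Rightarrow> nat) \<Rightarrow> (nat \<Rightarrow> nat) set" where
  "successors p Q \<delta> z = {w \<in> {1..Q} \<rightarrow>\<^sub>E {0..p}. \<forall>i\<in>{0..p}. \<forall>r\<in>{0..p}.
     card {q \<in> {1..Q}. z q = i \<and> w q = r} = \<delta> (i, r)}"

lemma finite_successors: "finite (successors p Q \<delta> z)"
  unfolding successors_def by (rule finite_subset[of _ "{1..Q} \<rightarrow>\<^sub>E {0..p}"]) (auto intro: finite_PiE)

text \<open>Profiles with the same occupation numbers differ by a permutation \<open>\<pi>\<close>
  of the entities, and relabelling along \<open>\<pi>\<close> carries successors of \<open>z\<close>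
  injectively to successors of \<open>z'\<close>. Exchanging the two profiles then gives
  equality.\<close>

lemma card_successors_le:
  assumes occ: "\<And>i. card {q \<in> {1..Q}. z q = i} = card {q \<in> {1..Q}. z' q = i}"
  shows "card (successors p Q \<delta> z) \<le> card (successors p Q \<delta> z')"
proof -
  \<comment> \<open>Occupation numbers are the multiplicities of the values of a profile. Equality
    of the multisets needs them for every \<open>i\<close>, not only for ratings up to
    \<open>p\<close>.\<close>
  have "image_mset z' (mset_set {1..Q}) = image_mset z (mset_set {1..Q})"
  proof (rule multiset_eqI)
    fix i
    show "count (image_mset z' (mset_set {1..Q})) i = count (image_mset z (mset_set {1..Q})) i"
      using occ[of i] by (simp add: count_image_mset' eq_commute[of i])
  qed
  then obtain \<pi> where \<pi>: "\<pi> permutes {1..Q}" "\<forall>q\<in>{1..Q}. z' q = z (\<pi> q)"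
    using image_mset_eq_implies_permutes[of "{1..Q}" z' z] by blast
  have in\<pi>: "\<pi> q \<in> {1..Q} \<longleftrightarrow> q \<in> {1..Q}" for q
    using permutes_in_image[OF \<pi>(1)] .
  define g where "g w = restrict (w \<circ> \<pi>) {1..Q}" for w :: "nat \<Rightarrow> nat"
  have "inj_on g (successors p Q \<delta> z)"
  proof (rule inj_onI)
    fix v w assume v: "v \<in> successors p Q \<delta> z" and w: "w \<in> successors p Q \<delta> z" and eq: "g v = g w"
    show "v = w"
    proof (rule PiE_ext)
      show "v \<in> {1..Q} \<rightarrow>\<^sub>E {0..p}" "w \<in> {1..Q} \<rightarrow>\<^sub>E {0..p}"
        using v w by (auto simp: successors_def)
      fix q assume "q \<in> {1..Q}"
      then obtain q' where q': "q' \<in> {1..Q}" "q = \<pi> q'"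
        using permutes_image[OF \<pi>(1)] by blast
      have "g v q' = g w q'" using eq by simp
      then show "v q = w q" using q' by (simp add: g_def)
    qed
  qed
  moreover have "g ` successors p Q \<delta> z \<subseteq> successors p Q \<delta> z'"
  proof
    fix u assume "u \<in> g ` successors p Q \<delta> z"
    then obtain w where w: "w \<in> successors p Q \<delta> z" "u = g w" by blast
    have "card {q \<in> {1..Q}. z' q = i \<and> u q = r} = \<delta> (i, r)" if "i \<in> {0..p}" "r \<in> {0..p}" for i r
    proof -
      have "\<pi> ` {q \<in> {1..Q}. z' q = i \<and> u q = r} = {q \<in> {1..Q}. z q = i \<and> w q = r}"
      proof
        show "\<pi> ` {q \<in> {1..Q}. z' q = i \<and> u q = r} \<subseteq> {q \<in> {1..Q}. z q = i \<and> w q = r}"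
          using w(2) \<pi>(2) in\<pi> by (auto simp: g_def)
        show "{q \<in> {1..Q}. z q = i \<and> w q = r} \<subseteq> \<pi> ` {q \<in> {1..Q}. z' q = i \<and> u q = r}"
        proof
          fix q assume q: "q \<in> {q \<in> {1..Q}. z q = i \<and> w q = r}"
          then have "q \<in> {1..Q}" by simp
          then obtain q' where q': "q' \<in> {1..Q}" "q = \<pi> q'"
            using permutes_image[OF \<pi>(1)] by blast
          then show "q \<in> \<pi> ` {q \<in> {1..Q}. z' q = i \<and> u q = r}"
            using q w(2) \<pi>(2) by (auto simp: g_def)
        qed
      qed
      moreover have "inj_on \<pi> {q \<in> {1..Q}. z' q = i \<and> u q = r}"
        using permutes_inj_on[OF \<pi>(1)] by blast
      ultimately show ?thesis
        using w(1) that card_image[of \<pi> "{q \<in> {1..Q}. z' q = i \<and> u q = r}"] unfolding successors_def by simp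
    qed
    moreover have "u \<in> {1..Q} \<rightarrow>\<^sub>E {0..p}"
    proof (rule PiE_I)
      fix q assume "q \<in> {1..Q}"
      then have "\<pi> q \<in> {1..Q}" "u q = w (\<pi> q)" using w(2) in\<pi> by (auto simp: g_def)
      moreover have "w \<in> {1..Q} \<rightarrow>\<^sub>E {0..p}" using w(1) by (simp add: successors_def)
      ultimately show "u q \<in> {0..p}" by (metis PiE_mem)
    qed (auto simp: w(2) g_def)
    ultimately show "u \<in> successors p Q \<delta> z'" by (auto simp: successors_def)
  qed
  ultimately show ?thesis by (rule card_inj_on_le[OF _ _ finite_successors])
qed

lemma card_successors_cong:
  assumes "\<And>i. card {q \<in> {1..Q}. z q = i} = card {q \<in> {1..Q}. z' q = i}"
  shows "card (successors p Q \<delta> z) = card (successors p Q \<delta> z')"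
  using card_successors_le[of Q z z'] card_successors_le[of Q z' z] assms by (simp add: antisym)

text \<open>Entities are grouped by their pair of old and new rating; being a successor means that
  the pair \<open>(i, r)\<close> occurs exactly \<open>\<delta> (i, r)\<close> times. Hence all
  successors share the same product.\<close>

lemma prod_transitions_eq:
  fixes f :: "nat \<Rightarrow> nat \<Rightarrow> real"
  assumes z: "\<And>q. q \<in> {1..Q} \<Longrightarrow> z q \<in> {0..p}" and w: "w \<in> successors p Q \<delta> z"
  shows "(\<Prod>q=1..Q. f (z q) (w q)) = (\<Prod>i=0..p. \<Prod>r=0..p. f i r ^ \<delta> (i, r))"
proof -
  have wr: "w q \<in> {0..p}" if "q \<in> {1..Q}" for q
    using w that unfolding successors_def by (metis (no_types, lifting) PiE_mem mem_Collect_eq)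
  have "(\<Prod>q=1..Q. f (z q) (w q)) =
      (\<Prod>x\<in>{0..p} \<times> {0..p}. \<Prod>q\<in>{q \<in> {1..Q}. (z q, w q) = x}. f (z q) (w q))"
    using z wr by (intro prod.group[symmetric]) auto
  also have "\<dots> = (\<Prod>x\<in>{0..p} \<times> {0..p}. f (fst x) (snd x) ^ \<delta> x)"
  proof (rule prod.cong[OF refl])
    fix x assume x: "x \<in> {0..p} \<times> {0..p}"
    have "(\<Prod>q\<in>{q \<in> {1..Q}. (z q, w q) = x}. f (z q) (w q))
        = (\<Prod>q\<in>{q \<in> {1..Q}. (z q, w q) = x}. f (fst x) (snd x))"
      by (rule prod.cong) auto
    also have "\<dots> = f (fst x) (snd x) ^ card {q \<in> {1..Q}. z q = fst x \<and> w q = snd x}"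
      by (cases x) simp
    also have "card {q \<in> {1..Q}. z q = fst x \<and> w q = snd x} = \<delta> x"
      using w x by (auto simp: successors_def)
    finally show "(\<Prod>q\<in>{q \<in> {1..Q}. (z q, w q) = x}. f (z q) (w q)) = f (fst x) (snd x) ^ \<delta> x" .
  qed
  finally show ?thesis
    by (simp add: prod.cartesian_product case_prod_beta')
qed

section \<open>Conditional probabilities on atoms, and finite decompositions\<close>

text \<open>A \<open>G\<close>-measurable function is almost surely constant on a set that
  \<open>G\<close> cannot split into two non-null pieces, and integrating over \<open>D\<close>
  identifies the constant. A null \<open>D\<close> is avoided almost surely, which is why positivity
  can be part of the conclusion.\<close>

lemma (in prob_space) cond_prob_given_atom:
  assumes G: "subalgebra M G" and D: "D \<in> sets G" and E: "E \<in> sets M"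
    and atom: "\<And>A. A \<in> sets G \<Longrightarrow> prob (A \<inter> D) = 0 \<or> prob (D - A) = 0"
  shows "AE \<omega> in M. \<omega> \<in> D \<longrightarrow> prob D > 0 \<and> cond_prob_given M G E \<omega> = prob (E \<inter> D) / prob D"
proof -
  interpret fms: finite_measure_subalgebra M G
    by unfold_locales (rule G)
  have Gs: "sets G \<subseteq> sets M" "space G = space M" using G by (auto simp: subalgebra_def)
  have DM [measurable]: "D \<in> sets M" using D Gs by blast
  note E [measurable]
  show ?thesis
  proof (cases "prob D = 0")
    case True
    then have "D \<in> null_sets M"
      by (simp add: emeasure_eq_measure null_sets_def)
    then show ?thesis by (rule AE_not_in[THEN eventually_mono]) simp
  next
    case False
    define v where "v = prob (E \<inter> D) / prob D"
    define g where "g = cond_prob_given M G E"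
    have gG: "g \<in> borel_measurable G" unfolding g_def by simp
    have [measurable]: "g \<in> borel_measurable M"
      unfolding g_def by simp
    have int1: "integrable M (indicator E :: _ \<Rightarrow> real)"
      by (simp add: emeasure_eq_measure)
    have intg: "integrable M g" unfolding g_def by (rule fms.real_cond_exp_int(1)[OF int1])
    \<comment> \<open>The sign \<open>c\<close> treats the events \<open>g > v\<close> and
      \<open>g < v\<close> at once. If such an event met \<open>D\<close> in positive probability,
      it would fill \<open>D\<close> up to a null set; the integral of \<open>c * (g - v)\<close>
      over it would then be zero although the integrand is positive there.\<close>
    have null: "prob (A \<inter> D) = 0"
      if A: "A \<in> sets G" and pos: "\<And>\<omega>. \<omega> \<in> A \<Longrightarrow> c * (g \<omega> - v) > 0" for A and c :: real
    proof (rule ccontr)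
      assume ne: "prob (A \<inter> D) \<noteq> 0"
      then have 0: "prob (D - A) = 0" using atom[OF A] by simp
      have AM [measurable]: "A \<in> sets M" using A Gs by blast
      have AD: "A \<inter> D \<in> sets G" using A D by blast
      have PAD: "prob (A \<inter> D) = prob D"
        using finite_measure_Diff'[of D A] 0 by (simp add: Int_commute)
      have "prob (E \<inter> D) = prob (E \<inter> (A \<inter> D)) + prob ((E \<inter> D) - A)"
        using finite_measure_Diff'[of "E \<inter> D" A] by (simp add: Int_ac)
      moreover have "prob ((E \<inter> D) - A) \<le> prob (D - A)" by (rule finite_measure_mono) auto
      ultimately have PE: "prob (E \<inter> (A \<inter> D)) = prob (E \<inter> D)"
        using 0 measure_nonneg[of M "E \<inter> D - A"] by simp
      have ii: "integrable M (\<lambda>x. indicator (A \<inter> D) x * g x)"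
        using integrable_mult_indicator[OF _ intg, of "A \<inter> D"] by simp
      have iv: "integrable M (\<lambda>x. v * indicator (A \<inter> D) x)"
        by (simp add: emeasure_eq_measure)
      have "(\<lambda>x. indicator (A \<inter> D) x * (c * (g x - v)))
          = (\<lambda>x. c * (indicator (A \<inter> D) x * g x - v * indicator (A \<inter> D) x))"
        by (rule ext) (simp add: algebra_simps)
      then have "(\<integral>x. indicator (A \<inter> D) x * (c * (g x - v)) \<partial>M)
          = c * ((\<integral>x. indicator (A \<inter> D) x * g x \<partial>M) - (\<integral>x. v * indicator (A \<inter> D) x \<partial>M))"
        by (simp only: integral_mult_right_zero Bochner_Integration.integral_diff[OF ii iv])
      also have "(\<integral>x. indicator (A \<inter> D) x * g x \<partial>M) = prob (E \<inter> (A \<inter> D))"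
      proof -
        have "(\<integral>x. indicator (A \<inter> D) x * g x \<partial>M) = (\<integral>x\<in>A \<inter> D. indicator E x \<partial>M)"
          using fms.real_cond_exp_intA[OF int1 AD] unfolding set_lebesgue_integral_def g_def
          by simp
        also have "\<dots> = (\<integral>x. indicator (E \<inter> (A \<inter> D)) x \<partial>M)"
          unfolding set_lebesgue_integral_def
          by (rule Bochner_Integration.integral_cong) (auto split: split_indicator)
        finally show ?thesis by simp
      qed
      also have "prob (E \<inter> (A \<inter> D)) - (\<integral>x. v * indicator (A \<inter> D) x \<partial>M) = 0"
        using PE PAD False by (simp add: v_def)
      finally have I0: "(\<integral>x. indicator (A \<inter> D) x * (c * (g x - v)) \<partial>M) = 0" by simp
      have "AE x in M. indicator (A \<inter> D) x * (c * (g x - v)) = 0"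
      proof (subst integral_nonneg_eq_0_iff_AE[symmetric])
        show "integrable M (\<lambda>x. indicator (A \<inter> D) x * (c * (g x - v)))"
          using integrable_mult_indicator[of "A \<inter> D" M "\<lambda>x. c * (g x - v)"] intg by simp
      qed (use I0 pos in \<open>auto split: split_indicator intro: less_imp_le\<close>)
      then have "AE x in M. x \<notin> A \<inter> D"
        by eventually_elim (use pos in \<open>fastforce split: split_indicator_asm\<close>)
      then have "prob (A \<inter> D) = 0"
        by (simp add: prob_eq_0)
      with ne show False by simp
    qed
    have up: "prob ({\<omega> \<in> space M. g \<omega> > v} \<inter> D) = 0"
    proof (rule null[of _ 1])
      show "{\<omega> \<in> space M. g \<omega> > v} \<in> sets G"
        using borel_measurable_less[OF borel_measurable_const gG] Gs by (simp add: gG)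
    qed auto
    have lo: "prob ({\<omega> \<in> space M. g \<omega> < v} \<inter> D) = 0"
    proof (rule null[of _ "-1"])
      show "{\<omega> \<in> space M. g \<omega> < v} \<in> sets G"
        using borel_measurable_less[OF gG borel_measurable_const] Gs by (simp add: gG)
    qed auto
    have "AE \<omega> in M. \<omega> \<notin> {\<omega> \<in> space M. g \<omega> > v} \<inter> D"
      using up by (subst prob_eq_0[symmetric]) auto
    moreover have "AE \<omega> in M. \<omega> \<notin> {\<omega> \<in> space M. g \<omega> < v} \<inter> D"
      using lo by (subst prob_eq_0[symmetric]) auto
    ultimately show ?thesis
      using AE_space
    proof eventually_elim
      case (elim \<omega>)
      then show ?case using False by (auto simp: g_def v_def less_le not_less)
    qed
  qed
qed

lemma (in prob_space) prob_eq_sum_fibres: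
  assumes "finite I" "\<And>x. x \<in> I \<Longrightarrow> {\<omega> \<in> E. f \<omega> = x} \<in> events" "\<And>\<omega>. \<omega> \<in> E \<Longrightarrow> f \<omega> \<in> I"
  shows "prob E = (\<Sum>x\<in>I. prob {\<omega> \<in> E. f \<omega> = x})"
proof -
  have "E = (\<Union>x\<in>I. {\<omega> \<in> E. f \<omega> = x})" using assms(3) by auto
  moreover have "prob (\<Union>x\<in>I. {\<omega> \<in> E. f \<omega> = x}) = (\<Sum>x\<in>I. prob {\<omega> \<in> E. f \<omega> = x})"
    using assms(1,2) by (intro finite_measure_finite_Union) (auto simp: disjoint_family_on_def)
  ultimately show ?thesis by simp
qed

text \<open>This isolates the censoring factors, those with \<open>i = 0\<close> or
  \<open>r = 0\<close>. The column product starts at \<open>i = 1\<close>, so the entry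
  \<open>(0, 0)\<close> is taken only once.\<close>

lemma prod_atMost_split_zero:
  fixes g :: "nat \<Rightarrow> nat \<Rightarrow> real"
  shows "(\<Prod>i=0..p. \<Prod>r=0..p. g i r)
    = ((\<Prod>r=0..p. g 0 r) * (\<Prod>i=1..p. g i 0)) * (\<Prod>i=1..p. \<Prod>r=1..p. g i r)"
proof -
  have split: "(\<Prod>i=0..p. f i) = f 0 * (\<Prod>i=1..p. f i)" for f :: "nat \<Rightarrow> real"
    using prod.atLeast_Suc_atMost[of 0 p f] by simp
  have "(\<Prod>i=0..p. \<Prod>r=0..p. g i r) = (\<Prod>r=0..p. g 0 r) * (\<Prod>i=1..p. \<Prod>r=0..p. g i r)"
    by (rule split)
  also have "(\<Prod>i=1..p. \<Prod>r=0..p. g i r) = (\<Prod>i=1..p. g i 0 * (\<Prod>r=1..p. g i r))"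
    by (intro prod.cong[OF refl] split)
  finally show ?thesis by (simp only: prod.distrib mult.assoc)
qed

section \<open>History cells of the transition counts\<close>

text \<open>For \<open>\<omega>\<close> in the space this is the atom containing
  \<open>\<omega>\<close> of the sigma-algebra generated by the counts up to time \<open>n\<close>,
  before null sets are added.\<close>

definition history_cell ::
    "'a measure \<Rightarrow> nat \<Rightarrow> nat \<Rightarrow> (nat \<Rightarrow> nat \<Rightarrow> 'a \<Rightarrow> nat) \<Rightarrow> nat \<Rightarrow> 'a \<Rightarrow> 'a set" where
  "history_cell M p Q Z n \<omega> = {\<omega>' \<in> space M. \<forall>k\<in>{..n}. \<forall>i\<in>{..p}. \<forall>r\<in>{..p}.
     transition_count Q Z i r k \<omega>' = transition_count Q Z i r k \<omega>}"

text \<open>A cell is determined by finitely many natural numbers. Countability allows one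
  exceptional null set to serve all cells.\<close>

lemma countable_history_cells: "countable (range (history_cell M p Q Z n))"
proof -
  let ?I = "{..n} \<times> {..p} \<times> {..p}"
  let ?C = "\<lambda>w. {\<omega>' \<in> space M. \<forall>k\<in>{..n}. \<forall>i\<in>{..p}. \<forall>r\<in>{..p}. transition_count Q Z i r k \<omega>' = w (k, i, r)}"
  have "range (history_cell M p Q Z n) \<subseteq> ?C ` (\<Pi>\<^sub>E x\<in>?I. UNIV)"
  proof
    fix C assume "C \<in> range (history_cell M p Q Z n)"
    then obtain \<omega> where "C = history_cell M p Q Z n \<omega>" by blast
    moreover define w where "w = restrict (\<lambda>x. transition_count Q Z (fst (snd x)) (snd (snd x)) (fst x) \<omega>) ?I"
    then have "w (k, i, r) = transition_count Q Z i r k \<omega>" if "k \<le> n" "i \<le> p" "r \<le> p" for k i r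
      using that by simp
    ultimately have "C = ?C w"
      unfolding history_cell_def by simp
    moreover have "w \<in> (\<Pi>\<^sub>E x\<in>?I. UNIV)" unfolding w_def by simp
    ultimately show "C \<in> ?C ` (\<Pi>\<^sub>E x\<in>?I. UNIV)" by (rule image_eqI)
  qed
  moreover have "countable (\<Pi>\<^sub>E x\<in>?I. UNIV :: nat set)" by (rule countable_PiE) auto
  ultimately show ?thesis by (meson countable_image countable_subset)
qed

lemma transition_incr_eq:
  assumes "n \<ge> 1"
  shows "transition_incr Q Z i r n \<omega> = card {q \<in> {1..Q}. Z q (n - 1) \<omega> = i \<and> Z q n \<omega> = r}"
proof -
  obtain k where n: "n = Suc k" using assms by (cases n) auto
  have "(\<Sum>q=1..Q. of_bool (Z q k \<omega> = i \<and> Z q n \<omega> = r)) = card {q \<in> {1..Q}. Z q k \<omega> = i \<and> Z q n \<omega> = r}"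
    by (simp add: Int_def)
  then show ?thesis by (simp add: transition_incr_def n)
qed

lemma transition_incr_le_at_risk:
  assumes "n \<ge> 1"
  shows "transition_incr Q Z i r n \<omega> \<le> at_risk Q Z i n \<omega>"
  unfolding transition_incr_eq[OF assms] at_risk_def by (intro card_mono) auto

text \<open>Each count at time \<open>n\<close> is the count at time \<open>n - 1\<close> plus the
  increment, so passing to the finer cell amounts to fixing the increments.\<close>

lemma history_cell_step:
  assumes "n \<ge> 1"
  shows "history_cell M p Q Z n \<omega> = {\<omega>' \<in> history_cell M p Q Z (n - 1) \<omega>. \<forall>i\<in>{0..p}. \<forall>r\<in>{0..p}.
    transition_incr Q Z i r n \<omega>' = transition_incr Q Z i r n \<omega>}"
proof -
  obtain k where n: "n = Suc k" using assms by (cases n) auto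
  have "transition_count Q Z i r n x = transition_count Q Z i r k x + transition_incr Q Z i r n x" for i r x
    by (simp add: n transition_incr_def)
  moreover have "(\<forall>k'\<in>{..n}. P k') \<longleftrightarrow> (\<forall>k'\<in>{..k}. P k') \<and> P n" for P :: "nat \<Rightarrow> bool"
    by (auto simp: n le_Suc_eq)
  ultimately show ?thesis unfolding history_cell_def by (auto simp: n)
qed

section \<open>Measurability of counts and cells in the model\<close>

context rating_model
begin

lemma F_sets: "n \<le> \<Gamma> \<Longrightarrow> A \<in> sets (F n) \<Longrightarrow> A \<in> events"
  and F_space: "n \<le> \<Gamma> \<Longrightarrow> space (F n) = space M"
  using subalg[of n] by (auto simp: subalgebra_def)

lemma F_measurable_mono:
  assumes "f \<in> measurable (F k) N" "k \<le> n" "n \<le> \<Gamma>"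
  shows "f \<in> measurable (F n) N"
proof -
  have "subalgebra (F n) (F k)"
    using mono[OF assms(2,3)] F_space[of k] F_space[of n] assms by (simp add: subalgebra_def)
  then show ?thesis using assms(1) by (rule measurable_from_subalg)
qed

lemma F_measurable_events:
  assumes "f \<in> measurable (F n) (count_space UNIV)" "n \<le> \<Gamma>"
  shows "f \<in> measurable M (count_space UNIV)"
  using measurable_from_subalg[OF subalg[OF assms(2)] assms(1)] .

lemma transition_count_measurable:
  assumes "k \<le> \<Gamma>"
  shows "transition_count Q Z i r k \<in> measurable (F k) (count_space UNIV)"
  using assms
proof (induction k)
  case 0
  have "transition_count Q Z i r 0 = (\<lambda>\<omega>. 0)" by (rule ext) simp
  then show ?case by simp
next
  case (Suc k)
  have step: "transition_count Q Z i r (Suc k) = (\<lambda>\<omega>. transition_count Q Z i r k \<omega>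
      + (\<Sum>q=1..Q. if Z q k \<omega> = i \<and> Z q (Suc k) \<omega> = r then 1 else 0))"
    by (rule ext) (simp only: transition_count.simps of_bool_def)
  have [measurable]: "transition_count Q Z i r k \<in> measurable (F (Suc k)) (count_space UNIV)"
    by (rule F_measurable_mono[of _ k]) (use Suc in auto)
  have [measurable]: "(\<lambda>\<omega>. \<Sum>q=1..Q. if Z q k \<omega> = i \<and> Z q (Suc k) \<omega> = r then 1 else 0 :: nat)
      \<in> measurable (F (Suc k)) (count_space UNIV)"
  proof (rule measurable_sum_nat)
    fix q assume q: "q \<in> {1..Q}"
    have [measurable]: "Z q k \<in> measurable (F (Suc k)) (count_space UNIV)"
      by (rule F_measurable_mono[of _ k]) (use Z_adapted[OF q, of k] Suc.prems in auto)
    have [measurable]: "Z q (Suc k) \<in> measurable (F (Suc k)) (count_space UNIV)"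
      using Z_adapted[OF q Suc.prems] .
    show "(\<lambda>\<omega>. if Z q k \<omega> = i \<and> Z q (Suc k) \<omega> = r then 1 else 0 :: nat)
        \<in> measurable (F (Suc k)) (count_space UNIV)"
      by measurable
  qed
  show ?case unfolding step by measurable
qed

lemma history_cell_sets_F: "n \<le> \<Gamma> \<Longrightarrow> history_cell M p Q Z n \<omega> \<in> sets (F n)"
proof -
  assume n: "n \<le> \<Gamma>"
  have [measurable]: "transition_count Q Z i r k \<in> measurable (F n) (count_space UNIV)" if "k \<le> n" for i r k
    by (rule F_measurable_mono[of _ k]) (use transition_count_measurable[of k i r] that n in auto)
  have "{\<omega>' \<in> space (F n). \<forall>k\<in>{..n}. \<forall>i\<in>{..p}. \<forall>r\<in>{..p}.
     transition_count Q Z i r k \<omega>' = transition_count Q Z i r k \<omega>} \<in> sets (F n)"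
    by measurable
  then show ?thesis unfolding history_cell_def F_space[OF n] .
qed

section \<open>The augmented count filtration and its atoms\<close>

abbreviation (input) count_generators :: "nat \<Rightarrow> 'a set set" where
  "count_generators n \<equiv>
     {transition_count Q Z i r k -` A \<inter> space M | i r k A. i \<le> p \<and> r \<le> p \<and> k \<le> n} \<union> null_sets M"

lemma count_generators_events:
  assumes n: "n \<le> \<Gamma>"
  shows "count_generators n \<subseteq> events"
proof
  fix B assume "B \<in> count_generators n"
  then consider "B \<in> null_sets M"
    | i r k A where "B = transition_count Q Z i r k -` A \<inter> space M" "k \<le> n"
    by blast
  then show "B \<in> events"
  proof cases
    case 2
    then have k: "k \<le> \<Gamma>" using n by simp
    show ?thesis unfolding 2(1)
      by (rule measurable_sets[OF F_measurable_events[OF transition_count_measurable[OF k] k]]) simp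
  qed (rule null_setsD2)
qed

lemma sets_count_filtration:
  "n \<le> \<Gamma> \<Longrightarrow> sets (count_filtration M p Q Z n) = sigma_sets (space M) (count_generators n)"
  unfolding count_filtration_def
  by (rule sets_measure_of) (rule order_trans[OF count_generators_events sets.space_closed])

lemma space_count_filtration: "n \<le> \<Gamma> \<Longrightarrow> space (count_filtration M p Q Z n) = space M"
  unfolding count_filtration_def
  by (rule space_measure_of) (rule order_trans[OF count_generators_events sets.space_closed])

lemma subalgebra_count_filtration: "n \<le> \<Gamma> \<Longrightarrow> subalgebra M (count_filtration M p Q Z n)"
  unfolding subalgebra_def sets_count_filtration space_count_filtration
  by (intro conjI sets.sigma_sets_subset count_generators_events refl)

lemma history_cell_sets_count_filtration:
  assumes n: "n \<le> \<Gamma>"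
  shows "history_cell M p Q Z n \<omega> \<in> sets (count_filtration M p Q Z n)"
proof -
  let ?G = "count_filtration M p Q Z n"
  have "{\<omega>' \<in> space ?G. transition_count Q Z i r k \<omega>' = transition_count Q Z i r k \<omega>} \<in> sets ?G"
    if "k \<le> n" "i \<le> p" "r \<le> p" for i r k
  proof -
    have "transition_count Q Z i r k -` {transition_count Q Z i r k \<omega>} \<inter> space M \<in> sets ?G"
      unfolding sets_count_filtration[OF n] using that by (intro sigma_sets.Basic) blast
    then show ?thesis
      by (simp add: space_count_filtration[OF n] vimage_def Int_def conj_commute)
  qed
  then have "{\<omega>' \<in> space ?G. \<forall>k\<in>{..n}. \<forall>i\<in>{..p}. \<forall>r\<in>{..p}.
     transition_count Q Z i r k \<omega>' = transition_count Q Z i r k \<omega>} \<in> sets ?G"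
    by (intro sets.sets_Collect_finite_All) auto
  then show ?thesis unfolding history_cell_def space_count_filtration[OF n] .
qed

text \<open>The null sets added to the filtration are why the atoms are only trivial up to null sets.\<close>

lemma history_cell_atom:
  assumes n: "n \<le> \<Gamma>" and A: "A \<in> sets (count_filtration M p Q Z n)"
  shows "prob (A \<inter> history_cell M p Q Z n \<omega>) = 0 \<or> prob (history_cell M p Q Z n \<omega> - A) = 0"
proof -
  let ?D = "history_cell M p Q Z n \<omega>"
  have D [measurable]: "?D \<in> events" using history_cell_sets_F[OF n] F_sets[OF n] by blast
  have sub: "B \<in> events" if "B \<in> sigma_sets (space M) (count_generators n)" for B
    using that sets.sigma_sets_subset[OF count_generators_events[OF n]] by blast
  from A show ?thesis
    unfolding sets_count_filtration[OF n]
  proof (induction rule: sigma_sets.induct)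
    case (Basic A)
    then consider "A \<in> null_sets M"
      | i r k B where "A = transition_count Q Z i r k -` B \<inter> space M" "i \<le> p" "r \<le> p" "k \<le> n"
      by blast
    then show ?case
    proof cases
      case 1
      then have "A \<inter> ?D \<in> null_sets M" by (simp add: null_set_Int2)
      then show ?thesis by (simp add: measure_eq_0_null_sets)
    next
      case 2
      \<comment> \<open>The count is constant on the cell, so a generator contains the cell or
        misses it.\<close>
      then have "?D \<subseteq> A \<or> A \<inter> ?D = {}"
        by (cases "transition_count Q Z i r k \<omega> \<in> B") (auto simp: history_cell_def)
      then show ?thesis by (metis Diff_eq_empty_iff measure_empty)
    qed
  next
    case Empty
    then show ?case by simp
  next
    case (Compl A)
    have "?D \<subseteq> space M" by (auto simp: history_cell_def)
    then have "(space M - A) \<inter> ?D = ?D - A" "?D - (space M - A) = A \<inter> ?D" by auto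
    then show ?case using Compl by metis
  next
    case (Union A)
    have ev: "A i \<in> events" for i using sub[OF Union.hyps] .
    show ?case
    \<comment> \<open>Either one of the sets already covers the cell up to a null set, and so does
      the union, or all of them meet the cell in null sets, and so does their countable
      union.\<close>
    proof (cases "\<exists>i. prob (?D - A i) = 0")
      case True
      then obtain i where "prob (?D - A i) = 0" by blast
      moreover have "prob (?D - \<Union> (range A)) \<le> prob (?D - A i)"
        using ev by (intro finite_measure_mono) auto
      ultimately show ?thesis by (metis measure_le_0_iff)
    next
      case False
      then have "prob (A i \<inter> ?D) = 0" for i using Union.IH by blast
      then have "A i \<inter> ?D \<in> null_sets M" for i
        using ev by (auto simp: null_sets_def emeasure_eq_measure)
      then have "(\<Union>i. A i \<inter> ?D) \<in> null_sets M" by (rule null_sets_UN)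
      then have "prob (\<Union>i. A i \<inter> ?D) = 0" by (rule measure_eq_0_null_sets)
      then show ?thesis by (simp add: Int_commute)
    qed
  qed
qed

text \<open>The formula for a single atom holds simultaneously on the countably many cells and is
  read off on the cell containing \<open>\<omega>\<close>. Positivity of that cell is retained for
  the cancellation in Bayes' formula.\<close>

lemma hidden_filter_history_cell:
  assumes n: "n \<le> \<Gamma>"
  shows "AE \<omega> in M. prob (history_cell M p Q Z n \<omega>) > 0 \<and>
    hidden_filter M p Q Z \<Theta> h n \<omega>
      = prob ({\<omega>' \<in> history_cell M p Q Z n \<omega>. \<Theta> n \<omega>' = h}) / prob (history_cell M p Q Z n \<omega>)"
proof -
  let ?G = "count_filtration M p Q Z n" and ?E = "{\<omega> \<in> space M. \<Theta> n \<omega> = h}"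
  have [measurable]: "\<Theta> n \<in> measurable M (count_space UNIV)"
    using F_measurable_events[OF Theta_adapted[OF n] n] .
  have "AE \<omega> in M. \<forall>D\<in>range (history_cell M p Q Z n). \<omega> \<in> D \<longrightarrow>
      prob D > 0 \<and> cond_prob_given M ?G ?E \<omega> = prob (?E \<inter> D) / prob D"
  proof (subst AE_ball_countable[OF countable_history_cells], intro ballI)
    fix D assume "D \<in> range (history_cell M p Q Z n)"
    then show "AE \<omega> in M. \<omega> \<in> D \<longrightarrow> prob D > 0 \<and> cond_prob_given M ?G ?E \<omega> = prob (?E \<inter> D) / prob D"
      using history_cell_atom[OF n] history_cell_sets_count_filtration[OF n] subalgebra_count_filtration[OF n]
      by (intro cond_prob_given_atom) auto
  qed
  then show ?thesis
    using AE_space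
  proof eventually_elim
    case (elim \<omega>)
    then have "\<omega> \<in> history_cell M p Q Z n \<omega>" by (simp add: history_cell_def)
    moreover have "?E \<inter> history_cell M p Q Z n \<omega> = {\<omega>' \<in> history_cell M p Q Z n \<omega>. \<Theta> n \<omega>' = h}"
      by (auto simp: history_cell_def)
    ultimately show ?case
      using bspec[OF elim(1) rangeI, of \<omega>] by (simp add: hidden_filter_def)
  qed
qed

section \<open>One-step transition law given the past\<close>

lemma Theta_events: "n \<le> \<Gamma> \<Longrightarrow> \<Theta> n \<in> measurable M (count_space UNIV)"
  by (rule F_measurable_events[OF Theta_adapted])

lemma Z_events: "q \<in> {1..Q} \<Longrightarrow> n \<le> \<Gamma> \<Longrightarrow> Z q n \<in> measurable M (count_space UNIV)"
  by (rule F_measurable_events[OF Z_adapted])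

text \<open>On \<open>B\<close> the hidden state and all ratings at time \<open>n - 1\<close> are
  fixed. Conditional independence therefore makes the conditional probability of the next state and
  profile constant on \<open>B\<close>, and integration over \<open>B\<close> multiplies it by
  \<open>prob B\<close>.\<close>

lemma joint_transition:
  assumes n: "n \<in> {1..\<Gamma>}" and h: "h \<in> {1..m}" and B: "B \<in> sets (F (n - 1))"
    and Bs: "\<And>\<omega>. \<omega> \<in> B \<Longrightarrow> \<Theta> (n - 1) \<omega> = s"
    and Bz: "\<And>\<omega> q. \<omega> \<in> B \<Longrightarrow> q \<in> {1..Q} \<Longrightarrow> Z q (n - 1) \<omega> = z q"
    and w: "\<And>q. q \<in> {1..Q} \<Longrightarrow> w q \<in> {0..p}"
  shows "prob {\<omega> \<in> B. \<Theta> n \<omega> = h \<and> (\<forall>q\<in>{1..Q}. Z q n \<omega> = w q)}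
    = prob B * (K s h * (\<Prod>q=1..Q. L s (z q) (w q)))"
proof -
  have n': "n \<le> \<Gamma>" "n - 1 \<le> \<Gamma>" using n by auto
  interpret fms: finite_measure_subalgebra M "F (n - 1)"
    by unfold_locales (rule subalg[OF n'(2)])
  let ?I = "insert None (Some ` {1..Q})"
  let ?X = "case_option (\<Theta> n) (\<lambda>q. Z q n)"
  let ?A = "case_option {h} (\<lambda>q. {w q})"
  let ?P = "cond_prob_given M (F (n - 1))"
  let ?E = "\<Inter>j\<in>?I. ?X j -` ?A j \<inter> space M"
  let ?c = "K s h * (\<Prod>q=1..Q. L s (z q) (w q))"
  have BM [measurable]: "B \<in> events" using F_sets[OF n'(2) B] .
  have Bsp: "B \<subseteq> space M" using sets.sets_into_space[OF BM] .
  have Xm: "?X j -` ?A j \<inter> space M \<in> events" if "j \<in> ?I" for j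
    using that measurable_sets[OF Theta_events[OF n'(1)]] measurable_sets[OF Z_events[OF _ n'(1)]]
    by (cases j) auto
  have EM [measurable]: "?E \<in> events"
    by (rule sets.finite_INT) (use Xm in auto)
  have "\<forall>J\<subseteq>?I. finite J \<longrightarrow> J \<noteq> {} \<longrightarrow> (\<forall>A\<in>(\<Pi> j\<in>J. sets (count_space UNIV)).
      AE \<omega> in M. ?P (\<Inter>j\<in>J. ?X j -` A j \<inter> space M) \<omega> = (\<Prod>j\<in>J. ?P (?X j -` A j \<inter> space M) \<omega>))"
    using cond_indep[OF n] unfolding cond_indep_vars_def by (rule conjunct2)
  \<comment> \<open>The whole index set is taken, with one singleton per variable; the index
    \<open>None\<close> keeps it nonempty even for \<open>Q = 0\<close>.\<close>
  from this[rule_format, of ?I ?A]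
  have "AE \<omega> in M. ?P ?E \<omega> = (\<Prod>j\<in>?I. ?P (?X j -` ?A j \<inter> space M) \<omega>)"
    by (rule) simp_all
  moreover have "AE \<omega> in M. ?P (?X None -` ?A None \<inter> space M) \<omega> = K (\<Theta> (n - 1) \<omega>) h"
  proof -
    have "?X None -` ?A None \<inter> space M = {\<omega> \<in> space M. \<Theta> n \<omega> = h}" by auto
    then show ?thesis using Theta_Markov[OF n h] by simp
  qed
  moreover have "AE \<omega> in M. \<forall>q\<in>{1..Q}. ?P (?X (Some q) -` ?A (Some q) \<inter> space M) \<omega>
      = L (\<Theta> (n - 1) \<omega>) (Z q (n - 1) \<omega>) (w q)"
  proof (intro AE_finite_allI)
    fix q assume q: "q \<in> {1..Q}"
    have "?X (Some q) -` ?A (Some q) \<inter> space M = {\<omega> \<in> space M. Z q n \<omega> = w q}" by auto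
    then show "AE \<omega> in M. ?P (?X (Some q) -` ?A (Some q) \<inter> space M) \<omega>
      = L (\<Theta> (n - 1) \<omega>) (Z q (n - 1) \<omega>) (w q)"
      using Z_cond_transition[OF q n w[OF q]] by simp
  qed simp
  ultimately have AE_c: "AE \<omega> in M. indicator B \<omega> * ?P ?E \<omega> = ?c * indicator B \<omega>"
  proof eventually_elim
    case (elim \<omega>)
    show ?case
    proof (cases "\<omega> \<in> B")
      case True
      have "?P ?E \<omega> = ?P (?X None -` ?A None \<inter> space M) \<omega>
          * (\<Prod>j\<in>Some ` {1..Q}. ?P (?X j -` ?A j \<inter> space M) \<omega>)"
        unfolding elim(1) by (rule prod.insert) auto
      also have "(\<Prod>j\<in>Some ` {1..Q}. ?P (?X j -` ?A j \<inter> space M) \<omega>)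
          = (\<Prod>q=1..Q. ?P (?X (Some q) -` ?A (Some q) \<inter> space M) \<omega>)"
        by (rule prod.reindex_cong[of Some]) auto
      also have "\<dots> = (\<Prod>q=1..Q. L s (z q) (w q))"
        using elim(3) Bs[OF True] Bz[OF True] by (intro prod.cong[OF refl]) (metis (no_types))
      also have "?P (?X None -` ?A None \<inter> space M) \<omega> = K s h"
        using elim(2) Bs[OF True] by simp
      finally show ?thesis using True by simp
    qed simp
  qed
  have int1: "integrable M (indicator ?E :: _ \<Rightarrow> real)"
    using EM by (subst integrable_indicator_iff) (auto simp: emeasure_eq_measure)
  have "{\<omega> \<in> B. \<Theta> n \<omega> = h \<and> (\<forall>q\<in>{1..Q}. Z q n \<omega> = w q)} = B \<inter> ?E"
    using Bsp by auto
  then have "prob {\<omega> \<in> B. \<Theta> n \<omega> = h \<and> (\<forall>q\<in>{1..Q}. Z q n \<omega> = w q)} = (\<integral>\<omega>. indicator (B \<inter> ?E) \<omega> \<partial>M)"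
    using BM EM by (simp only: sets.Int integral_indicator) (simp add: measure_def)
  also have "\<dots> = (\<integral>\<omega>\<in>B. indicator ?E \<omega> \<partial>M)"
    unfolding set_lebesgue_integral_def by (simp only: indicator_inter_arith real_scaleR_def)
  also have "\<dots> = (\<integral>\<omega>\<in>B. ?P ?E \<omega> \<partial>M)"
    by (rule fms.real_cond_exp_intA[OF int1 B])
  also have "\<dots> = (\<integral>\<omega>. ?c * indicator B \<omega> \<partial>M)"
    unfolding set_lebesgue_integral_def real_scaleR_def
    by (rule integral_cong_AE) (use AE_c in auto)
  also have "\<dots> = prob B * ?c" using BM by simp
  finally show ?thesis .
qed

text \<open>Total probability over the next state. The matrix is tied to the chain only at states of
  positive probability, so the row sum is available only there.\<close>

lemma K_row_sum:
  assumes n: "n \<in> {1..\<Gamma>}" and s: "s \<in> {1..m}" and pos: "\<P>(\<omega> in M. \<Theta> (n - 1) \<omega> = s) > 0"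
  shows "(\<Sum>h=1..m. K s h) = 1"
proof -
  have [measurable]: "\<Theta> n \<in> measurable M (count_space UNIV)"
    "\<Theta> (n - 1) \<in> measurable M (count_space UNIV)"
    using n by (auto intro!: Theta_events)
  let ?E = "{\<omega> \<in> space M. \<Theta> (n - 1) \<omega> = s}"
  have "prob ?E = (\<Sum>h=1..m. prob {\<omega> \<in> ?E. \<Theta> n \<omega> = h})"
  proof (rule prob_eq_sum_fibres)
    show "\<Theta> n \<omega> \<in> {1..m}" if "\<omega> \<in> ?E" for \<omega> using that n Theta_range[of n \<omega>] by simp
    have "{\<omega> \<in> ?E. \<Theta> n \<omega> = h} = {\<omega> \<in> space M. \<Theta> (n - 1) \<omega> = s \<and> \<Theta> n \<omega> = h}" for h by auto
    then show "{\<omega> \<in> ?E. \<Theta> n \<omega> = h} \<in> events" for h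
      by (simp only:) measurable
  qed simp
  also have "\<dots> = (\<Sum>h=1..m. K s h * prob ?E)"
  proof (rule sum.cong[OF refl])
    fix h assume h: "h \<in> {1..m}"
    have "{\<omega> \<in> ?E. \<Theta> n \<omega> = h} = {\<omega> \<in> space M. \<Theta> n \<omega> = h \<and> \<Theta> (n - 1) \<omega> = s}" by auto
    then show "prob {\<omega> \<in> ?E. \<Theta> n \<omega> = h} = K s h * prob ?E"
      using Theta_transition[OF n s h pos] pos by (simp add: cond_prob_def)
  qed
  finally show ?thesis using pos by (simp flip: sum_distrib_right)
qed

section \<open>Rating profiles and the law of the transition array on a cell\<close>

definition profile :: "nat \<Rightarrow> 'a \<Rightarrow> nat \<Rightarrow> nat" where
  "profile n \<omega> = restrict (\<lambda>q. Z q n \<omega>) {1..Q}"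

lemma profile_eq_iff:
  "z \<in> {1..Q} \<rightarrow>\<^sub>E {0..p} \<Longrightarrow> profile n \<omega> = z \<longleftrightarrow> (\<forall>q\<in>{1..Q}. Z q n \<omega> = z q)"
  unfolding profile_def by (auto simp: fun_eq_iff PiE_def extensional_def)

lemma profile_PiE: "n \<le> \<Gamma> \<Longrightarrow> \<omega> \<in> space M \<Longrightarrow> profile n \<omega> \<in> {1..Q} \<rightarrow>\<^sub>E {0..p}"
  unfolding profile_def using Z_range by auto

lemma profile_sets_F:
  assumes "n \<le> \<Gamma>" "D \<in> sets (F n)" and z: "z \<in> {1..Q} \<rightarrow>\<^sub>E {0..p}"
  shows "{\<omega> \<in> D. \<Theta> n \<omega> = s \<and> profile n \<omega> = z} \<in> sets (F n)" "{\<omega> \<in> D. profile n \<omega> = z} \<in> sets (F n)"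
proof -
  have [measurable]: "\<Theta> n \<in> measurable (F n) (count_space UNIV)"
    "\<And>q. q \<in> {1..Q} \<Longrightarrow> Z q n \<in> measurable (F n) (count_space UNIV)"
    using assms(1) Theta_adapted Z_adapted by auto
  have 1: "{\<omega> \<in> space (F n). \<Theta> n \<omega> = s} \<in> sets (F n)" by measurable
  have 2: "{\<omega> \<in> space (F n). \<forall>q\<in>{1..Q}. Z q n \<omega> = z q} \<in> sets (F n)" by measurable
  have D: "D \<subseteq> space (F n)" using assms(2) by (rule sets.sets_into_space)
  have "{\<omega> \<in> D. profile n \<omega> = z} = D \<inter> {\<omega> \<in> space (F n). \<forall>q\<in>{1..Q}. Z q n \<omega> = z q}"
    using D by (auto simp: profile_eq_iff[OF z])
  then show 3: "{\<omega> \<in> D. profile n \<omega> = z} \<in> sets (F n)"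
    using sets.Int[OF assms(2) 2] by simp
  have "{\<omega> \<in> D. \<Theta> n \<omega> = s \<and> profile n \<omega> = z}
      = {\<omega> \<in> D. profile n \<omega> = z} \<inter> {\<omega> \<in> space (F n). \<Theta> n \<omega> = s}"
    using D by auto
  then show "{\<omega> \<in> D. \<Theta> n \<omega> = s \<and> profile n \<omega> = z} \<in> sets (F n)"
    using sets.Int[OF 3 1] by simp
qed

text \<open>Predictability of the at-risk counts enters only here: up to a null set they are constant on an
  atom of the past.\<close>

lemma occupation_unique:
  assumes n: "n \<in> {1..\<Gamma>}"
    and z: "z \<in> {1..Q} \<rightarrow>\<^sub>E {0..p}" "prob {\<omega>' \<in> history_cell M p Q Z (n - 1) \<omega>. profile (n - 1) \<omega>' = z} \<noteq> 0"
    and z': "z' \<in> {1..Q} \<rightarrow>\<^sub>E {0..p}" "prob {\<omega>' \<in> history_cell M p Q Z (n - 1) \<omega>. profile (n - 1) \<omega>' = z'} \<noteq> 0"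
  shows "card {q \<in> {1..Q}. z q = i} = card {q \<in> {1..Q}. z' q = i}"
proof (cases "i \<in> {0..p}")
  \<comment> \<open>Ratings beyond \<open>p\<close> occur in neither profile; the case is needed
    because the comparison of successors asks for all \<open>i\<close>.\<close>
  case False
  then have "{q \<in> {1..Q}. z q = i} = {}" "{q \<in> {1..Q}. z' q = i} = {}"
    using z(1) z'(1) by (auto dest: PiE_mem)
  then show ?thesis by (simp only:)
next
  case True
  let ?D = "history_cell M p Q Z (n - 1) \<omega>" and ?G = "count_filtration M p Q Z (n - 1)"
  have n': "n - 1 \<le> \<Gamma>" using n by auto
  have occ: "at_risk Q Z i n \<omega>' = card {q \<in> {1..Q}. v q = i}"
    if "v \<in> {1..Q} \<rightarrow>\<^sub>E {0..p}" "profile (n - 1) \<omega>' = v" for v \<omega>'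
  proof -
    have "{q \<in> {1..Q}. Z q (n - 1) \<omega>' = i} = {q \<in> {1..Q}. v q = i}"
      using that(2) unfolding profile_eq_iff[OF that(1)] by auto
    then show ?thesis by (simp only: at_risk_def)
  qed
  \<comment> \<open>The at-risk count at time \<open>n\<close> depends on the ratings at time
    \<open>n - 1\<close>, so on the event that the profile is \<open>z\<close> it equals the
    occupation number of \<open>z\<close>. By predictability \<open>A\<close> belongs to the past
    count filtration; since it meets the atom in positive probability, it covers it up to a null
    set.\<close>
  define A where "A = at_risk Q Z i n -` {card {q \<in> {1..Q}. z q = i}} \<inter> space M"
  have "at_risk Q Z i n -` {card {q \<in> {1..Q}. z q = i}} \<inter> space ?G \<in> sets ?G"
    by (rule measurable_sets[OF at_risk_predictable[OF True n]]) simp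
  then have AG: "A \<in> sets ?G"
    unfolding A_def space_count_filtration[OF n'] .
  have AM: "A \<in> events" using AG subalgebra_count_filtration[OF n'] by (auto simp: subalgebra_def)
  have DM: "?D \<in> events" using history_cell_sets_F[OF n'] F_sets[OF n'] by blast
  have Dsp: "?D \<subseteq> space M" by (auto simp: history_cell_def)
  have "{\<omega>' \<in> ?D. profile (n - 1) \<omega>' = z} \<subseteq> A \<inter> ?D"
    using occ[OF z(1)] Dsp by (auto simp: A_def)
  then have "prob {\<omega>' \<in> ?D. profile (n - 1) \<omega>' = z} \<le> prob (A \<inter> ?D)"
    using AM DM by (intro finite_measure_mono) auto
  then have "prob (A \<inter> ?D) \<noteq> 0" using z(2) by (metis measure_le_0_iff)
  then have 0: "prob (?D - A) = 0" using history_cell_atom[OF n' AG] by blast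
  show ?thesis
  proof (rule ccontr)
    assume "\<not> ?thesis"
    then have "{\<omega>' \<in> ?D. profile (n - 1) \<omega>' = z'} \<subseteq> ?D - A"
      using occ[OF z'(1)] by (auto simp: A_def)
    then have "prob {\<omega>' \<in> ?D. profile (n - 1) \<omega>' = z'} \<le> prob (?D - A)"
      using AM DM by (intro finite_measure_mono) auto
    then show False using 0 z'(2) by (metis measure_le_0_iff)
  qed
qed

text \<open>The constant \<open>c\<close> is a product of multinomial coefficients; it is independent of \<open>s\<close> and \<open>h\<close>
  and cancels in the filter, so its value is not needed.\<close>

lemma prob_history_step:
  fixes \<omega> :: 'a
  assumes n: "n \<in> {1..\<Gamma>}"
  defines "D \<equiv> history_cell M p Q Z (n - 1) \<omega>"
  obtains c :: nat where "\<And>h. h \<in> {1..m} \<Longrightarrow>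
    prob {\<omega>' \<in> D. \<Theta> n \<omega>' = h \<and> (\<forall>i\<in>{0..p}. \<forall>r\<in>{0..p}. transition_incr Q Z i r n \<omega>' = \<delta> (i, r))}
    = real c * (\<Sum>s=1..m. K s h * (\<Prod>i=0..p. \<Prod>r=0..p. L s i r ^ \<delta> (i, r))
        * prob {\<omega>' \<in> D. \<Theta> (n - 1) \<omega>' = s})"
proof -
  let ?Pf = "{1..Q} \<rightarrow>\<^sub>E {0..p}" and ?S = "successors p Q \<delta>"
  have n': "n - 1 \<le> \<Gamma>" "n \<le> \<Gamma>" "1 \<le> n" using n by auto
  have DF: "D \<in> sets (F (n - 1))" unfolding D_def by (rule history_cell_sets_F[OF n'(1)])
  have Dsp: "\<omega>' \<in> space M" if "\<omega>' \<in> D" for \<omega>' using that by (simp add: D_def history_cell_def)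
  have finPf: "finite ?Pf" by (intro finite_PiE) auto
  \<comment> \<open>These events of the past fix both the hidden state and the rating profile, which
    a count history alone need not do.\<close>
  define B where "B s z = {\<omega>' \<in> D. \<Theta> (n - 1) \<omega>' = s \<and> profile (n - 1) \<omega>' = z}" for s z
  define full where "full s = (\<Prod>i=0..p. \<Prod>r=0..p. L s i r ^ \<delta> (i, r))" for s
  have BF: "B s z \<in> sets (F (n - 1))" if "z \<in> ?Pf" for s z
    unfolding B_def by (rule profile_sets_F(1)[OF n'(1) DF that])
  \<comment> \<open>The common number of successors of all profiles charged by \<open>D\<close>. If
    no profile is charged, any \<open>c\<close> will do.\<close>
  obtain c where c: "\<And>z. z \<in> ?Pf \<Longrightarrow> prob {\<omega>' \<in> D. profile (n - 1) \<omega>' = z} \<noteq> 0 \<Longrightarrow> card (?S z) = c"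
  proof (cases "\<exists>z\<in>?Pf. prob {\<omega>' \<in> D. profile (n - 1) \<omega>' = z} \<noteq> 0")
    case True
    then obtain z where z: "z \<in> ?Pf" "prob {\<omega>' \<in> D. profile (n - 1) \<omega>' = z} \<noteq> 0" by blast
    have "card (?S z') = card (?S z)"
      if "z' \<in> ?Pf" "prob {\<omega>' \<in> D. profile (n - 1) \<omega>' = z'} \<noteq> 0" for z'
      using occupation_unique[OF n that[unfolded D_def] z[unfolded D_def]] by (rule card_successors_cong)
    then show ?thesis using that by blast
  qed (use that in blast)
  \<comment> \<open>Profiles of probability zero may have a different number of successors, but
    weighting by \<open>prob (B s z)\<close> removes them.\<close>
  have cB: "real (card (?S z)) * prob (B s z) = real c * prob (B s z)" if z: "z \<in> ?Pf" for s z
  proof (cases "prob (B s z) = 0")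
    case False
    have "prob (B s z) \<le> prob {\<omega>' \<in> D. profile (n - 1) \<omega>' = z}"
      using F_sets[OF n'(1) profile_sets_F(2)[OF n'(1) DF z]] by (intro finite_measure_mono) (auto simp: B_def)
    then have "prob {\<omega>' \<in> D. profile (n - 1) \<omega>' = z} \<noteq> 0" using False by (metis measure_le_0_iff)
    then show ?thesis using c[OF z] by simp
  qed simp
  have sumB: "(\<Sum>z\<in>?Pf. prob (B s z)) = prob {\<omega>' \<in> D. \<Theta> (n - 1) \<omega>' = s}" for s
  proof -
    have eq: "{\<omega>' \<in> {\<omega>' \<in> D. \<Theta> (n - 1) \<omega>' = s}. profile (n - 1) \<omega>' = z} = B s z" for z
      by (auto simp: B_def)
    have "prob {\<omega>' \<in> D. \<Theta> (n - 1) \<omega>' = s}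
        = (\<Sum>z\<in>?Pf. prob {\<omega>' \<in> {\<omega>' \<in> D. \<Theta> (n - 1) \<omega>' = s}. profile (n - 1) \<omega>' = z})"
      by (rule prob_eq_sum_fibres[OF finPf])
        (use eq F_sets[OF n'(1) BF] profile_PiE[OF n'(1) Dsp] in auto)
    then show ?thesis by (simp only: eq)
  qed
  have "prob {\<omega>' \<in> D. \<Theta> n \<omega>' = h \<and> (\<forall>i\<in>{0..p}. \<forall>r\<in>{0..p}. transition_incr Q Z i r n \<omega>' = \<delta> (i, r))}
      = real c * (\<Sum>s=1..m. K s h * full s * prob {\<omega>' \<in> D. \<Theta> (n - 1) \<omega>' = s})"
    (is "prob ?E = _") if h: "h \<in> {1..m}" for h
  proof -
    \<comment> \<open>The event is split according to previous state, previous profile and next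
      profile. By \<open>in_S\<close>, the condition on the increments says exactly that the third
      component is a successor of the second.\<close>
    let ?f = "\<lambda>\<omega>'. (\<Theta> (n - 1) \<omega>', profile (n - 1) \<omega>', profile n \<omega>')"
    let ?I = "{1..m} \<times> Sigma ?Pf ?S"
    have in_S: "profile n \<omega>' \<in> ?S (profile (n - 1) \<omega>') \<longleftrightarrow>
        (\<forall>i\<in>{0..p}. \<forall>r\<in>{0..p}. transition_incr Q Z i r n \<omega>' = \<delta> (i, r))" if "\<omega>' \<in> space M" for \<omega>'
    proof -
      have "{q \<in> {1..Q}. profile (n - 1) \<omega>' q = i \<and> profile n \<omega>' q = r}
          = {q \<in> {1..Q}. Z q (n - 1) \<omega>' = i \<and> Z q n \<omega>' = r}" for i r
        by (auto simp: profile_def)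
      then show ?thesis
        using profile_PiE[OF n'(2) that] by (simp only: successors_def mem_Collect_eq transition_incr_eq[OF n'(3)] simp_thms)
    qed
    have SPf: "w \<in> ?Pf" if "w \<in> ?S z" for w z using that by (simp add: successors_def)
    have fib: "{\<omega>' \<in> ?E. ?f \<omega>' = (s, z, w)} = {\<omega>' \<in> B s z. \<Theta> n \<omega>' = h \<and> (\<forall>q\<in>{1..Q}. Z q n \<omega>' = w q)}"
      if "z \<in> ?Pf" "w \<in> ?S z" for s z w
    proof -
      have "(\<forall>q\<in>{1..Q}. Z q n \<omega>' = w q) \<longleftrightarrow> profile n \<omega>' = w" for \<omega>'
        using profile_eq_iff[OF SPf[OF that(2)]] by blast
      note q = this
      show ?thesis
      proof (rule set_eqI)
        fix \<omega>'
        show "\<omega>' \<in> {\<omega>' \<in> ?E. ?f \<omega>' = (s, z, w)} \<longleftrightarrow>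
            \<omega>' \<in> {\<omega>' \<in> B s z. \<Theta> n \<omega>' = h \<and> (\<forall>q\<in>{1..Q}. Z q n \<omega>' = w q)}"
          unfolding B_def mem_Collect_eq prod.inject q
          using in_S[OF Dsp, of \<omega>'] that(2) by metis
      qed
    qed
    have fib_prob: "prob {\<omega>' \<in> ?E. ?f \<omega>' = (s, z, w)} = prob (B s z) * (K s h * full s)"
      if zw: "z \<in> ?Pf" "w \<in> ?S z" for s z w
    proof -
      have "prob {\<omega>' \<in> B s z. \<Theta> n \<omega>' = h \<and> (\<forall>q\<in>{1..Q}. Z q n \<omega>' = w q)}
          = prob (B s z) * (K s h * (\<Prod>q=1..Q. L s (z q) (w q)))"
      proof (rule joint_transition[OF n h BF[OF zw(1)]])
        show "\<Theta> (n - 1) \<omega>' = s" if "\<omega>' \<in> B s z" for \<omega>' using that by (simp add: B_def)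
        show "Z q (n - 1) \<omega>' = z q" if "\<omega>' \<in> B s z" "q \<in> {1..Q}" for \<omega>' q
          using that profile_eq_iff[OF zw(1)] by (auto simp: B_def)
        show "w q \<in> {0..p}" if "q \<in> {1..Q}" for q using PiE_mem[OF SPf[OF zw(2)] that] .
      qed
      also have "(\<Prod>q=1..Q. L s (z q) (w q)) = full s"
        unfolding full_def by (rule prod_transitions_eq[OF _ zw(2)]) (rule PiE_mem[OF zw(1)])
      finally show ?thesis by (simp only: fib[OF zw])
    qed
    have "prob ?E = (\<Sum>x\<in>?I. prob {\<omega>' \<in> ?E. ?f \<omega>' = x})"
    proof (rule prob_eq_sum_fibres)
      show "finite ?I" using finPf finite_successors by (intro finite_cartesian_product finite_SigmaI) auto
      show "?f \<omega>' \<in> ?I" if E: "\<omega>' \<in> ?E" for \<omega>'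
      proof -
        have sp: "\<omega>' \<in> space M" using E Dsp by simp
        have "profile n \<omega>' \<in> ?S (profile (n - 1) \<omega>')"
          unfolding in_S[OF sp] using E by simp
        then show ?thesis
          by (intro SigmaI profile_PiE[OF n'(1) sp] Theta_range[OF n'(1) sp])
      qed
      fix x assume "x \<in> ?I"
      then obtain s z w where x: "x = (s, z, w)" "z \<in> ?Pf" "w \<in> ?S z" by blast
      have [measurable]: "\<Theta> n \<in> measurable M (count_space UNIV)"
        "\<And>q. q \<in> {1..Q} \<Longrightarrow> Z q n \<in> measurable M (count_space UNIV)"
        using Theta_events[OF n'(2)] Z_events[OF _ n'(2)] by auto
      have BM: "B s z \<in> events" using F_sets[OF n'(1) BF[OF x(2)]] .
      have "{\<omega> \<in> space M. \<Theta> n \<omega> = h \<and> (\<forall>q\<in>{1..Q}. Z q n \<omega> = w q)} \<in> events" by measurable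
      moreover have "{\<omega>' \<in> B s z. \<Theta> n \<omega>' = h \<and> (\<forall>q\<in>{1..Q}. Z q n \<omega>' = w q)}
          = B s z \<inter> {\<omega> \<in> space M. \<Theta> n \<omega> = h \<and> (\<forall>q\<in>{1..Q}. Z q n \<omega> = w q)}"
        using sets.sets_into_space[OF BM] by blast
      ultimately show "{\<omega>' \<in> ?E. ?f \<omega>' = x} \<in> events"
        unfolding x(1) fib[OF x(2,3)] using BM by (simp only: sets.Int)
    qed
    also have "\<dots> = (\<Sum>s=1..m. \<Sum>y\<in>Sigma ?Pf ?S. prob {\<omega>' \<in> ?E. ?f \<omega>' = (s, y)})"
      by (simp only: sum.cartesian_product case_prod_beta' prod.collapse)
    also have "\<dots> = (\<Sum>s=1..m. \<Sum>z\<in>?Pf. \<Sum>w\<in>?S z. prob {\<omega>' \<in> ?E. ?f \<omega>' = (s, z, w)})"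
    proof (rule sum.cong[OF refl])
      fix s
      show "(\<Sum>y\<in>Sigma ?Pf ?S. prob {\<omega>' \<in> ?E. ?f \<omega>' = (s, y)})
          = (\<Sum>z\<in>?Pf. \<Sum>w\<in>?S z. prob {\<omega>' \<in> ?E. ?f \<omega>' = (s, z, w)})"
        using sum.Sigma[OF finPf, of ?S "\<lambda>z w. prob {\<omega>' \<in> ?E. ?f \<omega>' = (s, z, w)}"]
        by (simp only: case_prod_beta' prod.collapse finite_successors ball_triv simp_thms)
    qed
    also have "\<dots> = (\<Sum>s=1..m. \<Sum>z\<in>?Pf. \<Sum>w\<in>?S z. prob (B s z) * (K s h * full s))"
      by (intro sum.cong[OF refl] fib_prob)
    also have "\<dots> = (\<Sum>s=1..m. \<Sum>z\<in>?Pf. (K s h * full s) * (real (card (?S z)) * prob (B s z)))"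
      by (simp only: sum_constant mult.assoc mult.commute mult.left_commute)
    also have "\<dots> = (\<Sum>s=1..m. \<Sum>z\<in>?Pf. (K s h * full s) * (real c * prob (B s z)))"
      by (intro sum.cong[OF refl] arg_cong2[where f = "(*)"] cB refl)
    also have "\<dots> = (\<Sum>s=1..m. (K s h * full s) * (real c * prob {\<omega>' \<in> D. \<Theta> (n - 1) \<omega>' = s}))"
      by (simp only: sum_distrib_left[symmetric] sumB)
    also have "\<dots> = real c * (\<Sum>s=1..m. K s h * full s * prob {\<omega>' \<in> D. \<Theta> (n - 1) \<omega>' = s})"
      by (simp only: sum_distrib_left mult.assoc mult.commute mult.left_commute)
    finally show ?thesis .
  qed
  then show ?thesis using that unfolding full_def by blast
qed

section \<open>Bayes' formula for the filter\<close>

text \<open>Outside a null set every filter value is a ratio of probabilities of parts of the cell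
  of \<open>\<omega>\<close>, so the claim becomes an identity between real numbers at a fixed
  \<open>\<omega>\<close>.\<close>

lemma hidden_filter_step:
  assumes n: "n \<in> {1..\<Gamma>}" and h: "h \<in> {1..m}"
  shows "AE \<omega> in M. hidden_filter M p Q Z \<Theta> h n \<omega> =
      (\<Sum>\<delta>\<in>jump_arrays p Q Z n \<omega>.
         (\<Sum>s=1..m. K s h * (\<Prod>i=1..p. \<Prod>r=1..p. L s i r ^ \<delta> (i, r))
            * hidden_filter M p Q Z \<Theta> s (n - 1) \<omega>)
         / (\<Sum>s=1..m. (\<Prod>i=1..p. \<Prod>r=1..p. L s i r ^ \<delta> (i, r))
            * hidden_filter M p Q Z \<Theta> s (n - 1) \<omega>)
         * of_bool (\<forall>i\<in>{0..p}. \<forall>r\<in>{0..p}. transition_incr Q Z i r n \<omega> = \<delta> (i, r)))"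
proof -
  have n': "n - 1 \<le> \<Gamma>" "n \<le> \<Gamma>" "1 \<le> n" using n by auto
  have "AE \<omega> in M. \<forall>s\<in>{1..m}. prob (history_cell M p Q Z (n - 1) \<omega>) > 0 \<and>
    hidden_filter M p Q Z \<Theta> s (n - 1) \<omega>
      = prob ({\<omega>' \<in> history_cell M p Q Z (n - 1) \<omega>. \<Theta> (n - 1) \<omega>' = s}) / prob (history_cell M p Q Z (n - 1) \<omega>)"
    by (intro AE_finite_allI hidden_filter_history_cell[OF n'(1)]) simp
  with hidden_filter_history_cell[OF n'(2), of h] show ?thesis
    using AE_space
  proof eventually_elim
    case (elim \<omega>)
    define D where "D = history_cell M p Q Z (n - 1) \<omega>"
    define D' where "D' = history_cell M p Q Z n \<omega>"
    \<comment> \<open>The observed transition array; restricting it makes it extensional, hence a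
      candidate element of \<open>jump_arrays\<close>.\<close>
    define \<delta>\<^sub>0 where "\<delta>\<^sub>0 = restrict (\<lambda>x. transition_incr Q Z (fst x) (snd x) n \<omega>) ({0..p} \<times> {0..p})"
    define a where "a s = prob {\<omega>' \<in> D. \<Theta> (n - 1) \<omega>' = s}" for s
    define P where "P \<delta> s = (\<Prod>i=1..p. \<Prod>r=1..p. L s i r ^ \<delta> (i, r))" for \<delta> s
    let ?hit = "\<lambda>\<delta>. \<forall>i\<in>{0..p}. \<forall>r\<in>{0..p}. transition_incr Q Z i r n \<omega> = \<delta> (i, r)"
    have \<delta>\<^sub>0: "\<delta>\<^sub>0 (i, r) = transition_incr Q Z i r n \<omega>" if "i \<in> {0..p}" "r \<in> {0..p}" for i r
      using that by (simp add: \<delta>\<^sub>0_def)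
    have D'pos: "prob D' > 0"
      and hf: "hidden_filter M p Q Z \<Theta> h n \<omega> = prob {\<omega>' \<in> D'. \<Theta> n \<omega>' = h} / prob D'"
      using elim(1) by (auto simp: D'_def)
    \<comment> \<open>Positivity sits under the quantifier over hidden states, which is not vacuous
      because \<open>h\<close> belongs to the range.\<close>
    have Dpos: "prob D > 0"
      and hf': "\<And>s. s \<in> {1..m} \<Longrightarrow> hidden_filter M p Q Z \<Theta> s (n - 1) \<omega> = a s / prob D"
      using elim(2) h by (auto simp: D_def a_def)
    have D'_eq: "{\<omega>' \<in> D'. \<Theta> n \<omega>' = k} = {\<omega>' \<in> D. \<Theta> n \<omega>' = k \<and>
        (\<forall>i\<in>{0..p}. \<forall>r\<in>{0..p}. transition_incr Q Z i r n \<omega>' = \<delta>\<^sub>0 (i, r))}" for k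
      unfolding D_def D'_def history_cell_step[OF n'(3)] using \<delta>\<^sub>0 by auto
    obtain c :: nat where c: "\<And>k. k \<in> {1..m} \<Longrightarrow> prob {\<omega>' \<in> D'. \<Theta> n \<omega>' = k}
        = real c * (\<Sum>s=1..m. K s k * (\<Prod>i=0..p. \<Prod>r=0..p. L s i r ^ \<delta>\<^sub>0 (i, r)) * a s)"
      using prob_history_step[OF n, of \<omega> \<delta>\<^sub>0] unfolding D'_eq a_def D_def by blast
    \<comment> \<open>The censoring factors, evaluated at \<open>h\<close> as a reference state; by
      non-informative censoring any other state gives the same value.\<close>
    define C where "C = (\<Prod>r=0..p. L h 0 r ^ \<delta>\<^sub>0 (0, r)) * (\<Prod>i=1..p. L h i 0 ^ \<delta>\<^sub>0 (i, 0))"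
    have full: "(\<Prod>i=0..p. \<Prod>r=0..p. L s i r ^ \<delta>\<^sub>0 (i, r)) = C * P \<delta>\<^sub>0 s" if s: "s \<in> {1..m}" for s
    proof -
      have "L s 0 r = L h 0 r" if "r \<in> {0..p}" for r
        using censoring_noninformative[OF s h, of 0 r] that by simp
      moreover have "L s i 0 = L h i 0" if "i \<in> {1..p}" for i
        using censoring_noninformative[OF s h, of i 0] that by simp
      ultimately show ?thesis
        unfolding prod_atMost_split_zero[of "\<lambda>i r. L s i r ^ \<delta>\<^sub>0 (i, r)"] C_def P_def by simp
    qed
    have joint: "prob {\<omega>' \<in> D'. \<Theta> n \<omega>' = k} = real c * C * (\<Sum>s=1..m. K s k * P \<delta>\<^sub>0 s * a s)"
      if "k \<in> {1..m}" for k
    proof -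
      have "(\<Sum>s=1..m. K s k * (\<Prod>i=0..p. \<Prod>r=0..p. L s i r ^ \<delta>\<^sub>0 (i, r)) * a s)
          = (\<Sum>s=1..m. C * (K s k * P \<delta>\<^sub>0 s * a s))"
        by (intro sum.cong[OF refl]) (simp add: full)
      then show ?thesis unfolding c[OF that] by (simp add: sum_distrib_left mult.assoc)
    qed
    have D'M: "D' \<in> events" unfolding D'_def by (rule F_sets[OF n'(2) history_cell_sets_F[OF n'(2)]])
    have D'sp: "D' \<subseteq> space M" using sets.sets_into_space[OF D'M] .
    have "prob D' = (\<Sum>k=1..m. prob {\<omega>' \<in> D'. \<Theta> n \<omega>' = k})"
    proof (rule prob_eq_sum_fibres)
      fix k
      have "{\<omega>' \<in> D'. \<Theta> n \<omega>' = k} = \<Theta> n -` {k} \<inter> space M \<inter> D'" using D'sp by auto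
      then show "{\<omega>' \<in> D'. \<Theta> n \<omega>' = k} \<in> events"
        using measurable_sets[OF Theta_events[OF n'(2)], of "{k}"] D'M by auto
    qed (use Theta_range[OF n'(2)] D'sp in auto)
    also have "\<dots> = real c * C * (\<Sum>k=1..m. \<Sum>s=1..m. K s k * P \<delta>\<^sub>0 s * a s)"
      by (simp only: joint sum_distrib_left cong: sum.cong)
    also have "(\<Sum>k=1..m. \<Sum>s=1..m. K s k * P \<delta>\<^sub>0 s * a s) = (\<Sum>s=1..m. \<Sum>k=1..m. K s k * P \<delta>\<^sub>0 s * a s)"
      by (rule sum.swap)
    also have "\<dots> = (\<Sum>s=1..m. P \<delta>\<^sub>0 s * a s)"
    proof (rule sum.cong[OF refl])
      fix s assume s: "s \<in> {1..m}"
      show "(\<Sum>k=1..m. K s k * P \<delta>\<^sub>0 s * a s) = P \<delta>\<^sub>0 s * a s"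
      \<comment> \<open>Where \<open>a s\<close> is positive, the state \<open>s\<close> has
        positive probability at time \<open>n - 1\<close> and its row of \<open>K\<close> sums to
        one; elsewhere both sides vanish.\<close>
      proof (cases "a s = 0")
        case False
        have "a s \<le> \<P>(\<omega>' in M. \<Theta> (n - 1) \<omega>' = s)"
        proof -
          have "\<Theta> (n - 1) -` {s} \<inter> space M \<in> events"
            using measurable_sets[OF Theta_events[OF n'(1)], of "{s}"] by simp
          moreover have "\<Theta> (n - 1) -` {s} \<inter> space M = {\<omega>' \<in> space M. \<Theta> (n - 1) \<omega>' = s}" by auto
          ultimately show ?thesis
            unfolding a_def by (intro finite_measure_mono) (auto simp: D_def history_cell_def)
        qed
        moreover have "a s > 0" using False by (simp add: a_def zero_less_measure_iff)
        ultimately have "(\<Sum>k=1..m. K s k) = 1" using K_row_sum[OF n s] by simp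
        then show ?thesis by (simp flip: sum_distrib_right)
      qed simp
    qed
    finally have total: "prob D' = real c * C * (\<Sum>s=1..m. P \<delta>\<^sub>0 s * a s)" .
    \<comment> \<open>The current cell has positive probability, so neither the number of successors
      nor the product of censoring factors can be zero, and both cancel.\<close>
    have nz: "real c * C \<noteq> 0"
      using D'pos total by (metis less_irrefl mult_zero_left)
    have \<delta>\<^sub>0_in: "\<delta>\<^sub>0 \<in> jump_arrays p Q Z n \<omega>"
      unfolding jump_arrays_def \<delta>\<^sub>0_def using transition_incr_le_at_risk[OF n'(3), of Q Z] by auto
    have fin: "finite (jump_arrays p Q Z n \<omega>)"
      unfolding jump_arrays_def by (rule finite_PiE) auto
    have unique: "\<delta> = \<delta>\<^sub>0" if "\<delta> \<in> jump_arrays p Q Z n \<omega>" "?hit \<delta>" for \<delta>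
    proof (rule PiE_ext)
      show "\<delta> \<in> (\<Pi>\<^sub>E (i, r) \<in> {0..p} \<times> {0..p}. {0..at_risk Q Z i n \<omega>})"
        "\<delta>\<^sub>0 \<in> (\<Pi>\<^sub>E (i, r) \<in> {0..p} \<times> {0..p}. {0..at_risk Q Z i n \<omega>})"
        using that(1) \<delta>\<^sub>0_in by (simp_all only: jump_arrays_def)
      fix x assume "x \<in> {0..p} \<times> {0..p}"
      then show "\<delta> x = \<delta>\<^sub>0 x" using that(2) \<delta>\<^sub>0 by (cases x) force
    qed
    define R where "R \<delta> = (\<Sum>s=1..m. K s h * P \<delta> s * hidden_filter M p Q Z \<Theta> s (n - 1) \<omega>)
        / (\<Sum>s=1..m. P \<delta> s * hidden_filter M p Q Z \<Theta> s (n - 1) \<omega>)" for \<delta>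
    \<comment> \<open>Only the observed array survives the indicator: increments are bounded by the
      at-risk counts, so it lies in the index set, and extensionality makes it the only
      match.\<close>
    have "(\<Sum>\<delta>\<in>jump_arrays p Q Z n \<omega>. R \<delta> * of_bool (?hit \<delta>)) = (\<Sum>\<delta>\<in>{\<delta>\<^sub>0}. R \<delta> * of_bool (?hit \<delta>))"
      by (rule sum.mono_neutral_right[OF fin]) (use \<delta>\<^sub>0_in unique in auto)
    also have "\<dots> = R \<delta>\<^sub>0" using \<delta>\<^sub>0 by simp
    also have "\<dots> = ((\<Sum>s=1..m. K s h * P \<delta>\<^sub>0 s * a s) / prob D) / ((\<Sum>s=1..m. P \<delta>\<^sub>0 s * a s) / prob D)"
    proof -
      have "(\<Sum>s=1..m. f s * hidden_filter M p Q Z \<Theta> s (n - 1) \<omega>) = (\<Sum>s=1..m. f s * a s) / prob D"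
        for f :: "nat \<Rightarrow> real"
        unfolding sum_divide_distrib by (intro sum.cong[OF refl]) (simp only: hf' times_divide_eq_right)
      then show ?thesis unfolding R_def by (simp only:)
    qed
    also have "\<dots> = (\<Sum>s=1..m. K s h * P \<delta>\<^sub>0 s * a s) / (\<Sum>s=1..m. P \<delta>\<^sub>0 s * a s)"
      using Dpos by simp
    also have "\<dots> = hidden_filter M p Q Z \<Theta> h n \<omega>"
      unfolding hf joint[OF h] total using nz by simp
    finally show ?case unfolding R_def P_def by simp
  qed
qed

end

theorem proposition3:
  fixes M :: "'a measure"
    and \<Gamma> m p Q h :: nat
    and F :: "nat \<Rightarrow> 'a measure"
    and \<Theta> :: "nat \<Rightarrow> 'a \<Rightarrow> nat"
    and K :: "nat \<Rightarrow> nat \<Rightarrow> real"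
    and Z :: "nat \<Rightarrow> nat \<Rightarrow> 'a \<Rightarrow> nat"
    and L :: "nat \<Rightarrow> nat \<Rightarrow> nat \<Rightarrow> real"
  assumes "rating_model M \<Gamma> F m \<Theta> K p Q Z L"
    and "h \<in> {1..m}"
  shows "AE \<omega> in M. \<forall>n\<in>{1..\<Gamma>}.
    hidden_filter M p Q Z \<Theta> h n \<omega> =
      (\<Sum>\<delta>\<in>jump_arrays p Q Z n \<omega>.
         (\<Sum>s=1..m. K s h * (\<Prod>i=1..p. \<Prod>r=1..p. L s i r ^ \<delta> (i, r))
            * hidden_filter M p Q Z \<Theta> s (n - 1) \<omega>)
         / (\<Sum>s=1..m. (\<Prod>i=1..p. \<Prod>r=1..p. L s i r ^ \<delta> (i, r))
            * hidden_filter M p Q Z \<Theta> s (n - 1) \<omega>)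
         * of_bool (\<forall>i\<in>{0..p}. \<forall>r\<in>{0..p}. transition_incr Q Z i r n \<omega> = \<delta> (i, r)))"
proof -
  interpret rating_model M \<Gamma> F m \<Theta> K p Q Z L by fact
  show ?thesis
    \<comment> \<open>There are finitely many times, so the exceptional null sets combine into
      one.\<close>
    by (intro AE_finite_allI hidden_filter_step assms(2)) simp
qed

end
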